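(* There exist infinitely many (pairwise non-isomorphic) $2$-connected $4$-regular multigraphs $G$ with $\chi_c'(G) = 4+\frac{2}{3}$.
   Context: Multigraphs are finite and loopless; parallel edges are allowed, and degrees count parallel edges with multiplicity. For a real number $r$, a circular $r$-edge-colouring of $G$ is a map $c$ assigning to each edge of $G$ a real number in $[0,r)$ such that any two distinct edges $e,f$ sharing at least one end-vertex (in particular, any two parallel edges) satisfy $1\le |c(e)-c(f)|\le r-1$. The circular chromatic index $\chi_c'(G)$ is the infimum (attained for finite multigraphs) of all $r$ such that $G$ admits a circular $r$-edge-colouring. "$2$-connected" refers to vertex connectivity. *)

theory Defs
  imports Complex_Main
begin

text \<open>Edges are objects of their own, so distinct edges may have the same ends (parallel edges).
  The value of \<open>ends\<close> outside \<open>edges\<close> is irrelevant, also for isomorphism.\<close>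

record ('v, 'e) multigraph =
  verts :: "'v set"
  edges :: "'e set"
  ends :: "'e \<Rightarrow> 'v set"

text \<open>The cardinality condition excludes loops.\<close>

definition finite_loopless_multigraph :: "('v, 'e) multigraph \<Rightarrow> bool" where
  "finite_loopless_multigraph G \<longleftrightarrow>
     finite (verts G) \<and> finite (edges G) \<and>
     (\<forall>e\<in>edges G. ends G e \<subseteq> verts G \<and> card (ends G e) = 2)"

definition degree :: "('v, 'e) multigraph \<Rightarrow> 'v \<Rightarrow> nat" where
  "degree G v = card {e \<in> edges G. v \<in> ends G e}"

definition regular :: "nat \<Rightarrow> ('v, 'e) multigraph \<Rightarrow> bool" where
  "regular k G \<longleftrightarrow> (\<forall>v\<in>verts G. degree G v = k)"

definition adj_rel :: "('v, 'e) multigraph \<Rightarrow> ('v \<times> 'v) set" where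
  "adj_rel G = {(u, v). \<exists>e\<in>edges G. ends G e = {u, v}}"

definition connected_multigraph :: "('v, 'e) multigraph \<Rightarrow> bool" where
  "connected_multigraph G \<longleftrightarrow>
     verts G \<noteq> {} \<and> (\<forall>u\<in>verts G. \<forall>v\<in>verts G. (u, v) \<in> (adj_rel G)\<^sup>*)"

definition delete_verts :: "('v, 'e) multigraph \<Rightarrow> 'v set \<Rightarrow> ('v, 'e) multigraph" where
  "delete_verts G X =
     \<lparr>verts = verts G - X, edges = {e \<in> edges G. ends G e \<inter> X = {}}, ends = ends G\<rparr>"

text \<open>Vertex connectivity: more than \<open>k\<close> vertices, and no set of fewer than \<open>k\<close> vertices
  disconnects the multigraph.\<close>

definition vertex_connected :: "nat \<Rightarrow> ('v, 'e) multigraph \<Rightarrow> bool" where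
  "vertex_connected k G \<longleftrightarrow>
     k < card (verts G) \<and>
     (\<forall>X\<subseteq>verts G. card X < k \<longrightarrow> connected_multigraph (delete_verts G X))"

definition isomorphic :: "('v, 'e) multigraph \<Rightarrow> ('w, 'f) multigraph \<Rightarrow> bool" where
  "isomorphic G H \<longleftrightarrow>
     (\<exists>f g. bij_betw f (verts G) (verts H) \<and> bij_betw g (edges G) (edges H) \<and>
        (\<forall>e\<in>edges G. ends H (g e) = f ` ends G e))"

definition circular_edge_colouring ::
    "('v, 'e) multigraph \<Rightarrow> real \<Rightarrow> ('e \<Rightarrow> real) \<Rightarrow> bool" where
  "circular_edge_colouring G r c \<longleftrightarrow>
     (\<forall>e\<in>edges G. 0 \<le> c e \<and> c e < r) \<and>
     (\<forall>e\<in>edges G. \<forall>f\<in>edges G. e \<noteq> f \<and> ends G e \<inter> ends G f \<noteq> {} \<longrightarrow>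
        1 \<le> \<bar>c e - c f\<bar> \<and> \<bar>c e - c f\<bar> \<le> r - 1)"

text \<open>The set is nonempty if \<open>G\<close> is finite, and bounded below by 0 if \<open>G\<close> has an edge;
  for edgeless \<open>G\<close> the infimum is a junk value.\<close>

definition circular_chromatic_index :: "('v, 'e) multigraph \<Rightarrow> real" where
  "circular_chromatic_index G = Inf {r. \<exists>c. circular_edge_colouring G r c}"

end

theory Submission
  imports Defs "HOL-Number_Theory.Cong"
begin

text \<open>The graphs are rings consisting of one rigid gadget on seven vertices and any number of pairs
  of vertices joined by three parallel edges. The gadget has thirteen inner edges and one pendant
  edge at each of two of its vertices; these fifteen edges already have no circular
  \<open>r\<close>-edge-colouring with \<open>r < 14 / 3\<close>: once a rotation has made one colour 0, this is a finite
  case analysis in linear real arithmetic on the order of the colours. At \<open>r = 14 / 3\<close> the gadget can be coloured with equal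
  colours on the two pendant edges, and then all single edges of the ring can get that colour.\<close>

section \<open>Circular colourings: rotation and conditions at vertices\<close>

definition apart :: "real \<Rightarrow> real \<Rightarrow> real \<Rightarrow> bool" where
  "apart r x y \<longleftrightarrow> 1 \<le> \<bar>x - y\<bar> \<and> \<bar>x - y\<bar> \<le> r - 1"

lemma apart_sym: "apart r x y \<longleftrightarrow> apart r y x"
  by (auto simp: apart_def abs_minus_commute)

text \<open>Turning the circle of length \<open>r\<close> changes a difference of two colours by 0
  or by \<open>r\<close> up to sign. In the latter case its absolute value \<open>d\<close> becomes
  \<open>r - d\<close>, and the condition 1 \<le> d \<le> r - 1 is symmetric under this
  exchange.\<close>

lemma circular_edge_colouring_rotate:
  assumes c: "circular_edge_colouring G r c" and e0: "e0 \<in> edges G"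
  obtains c' where "circular_edge_colouring G r c'" "c' e0 = 0"
proof
  define c' where "c' e = (if c e0 \<le> c e then c e - c e0 else c e - c e0 + r)" for e
  have e0_range: "0 \<le> c e0" "c e0 < r"
    using c e0 by (auto simp: circular_edge_colouring_def)
  show "circular_edge_colouring G r c'"
    unfolding circular_edge_colouring_def
  proof (intro conjI ballI impI)
    fix e assume "e \<in> edges G"
    then have "0 \<le> c e" "c e < r"
      using c by (auto simp: circular_edge_colouring_def)
    then show "0 \<le> c' e" "c' e < r"
      using e0_range by (auto simp: c'_def)
  next
    fix e f assume "e \<in> edges G" "f \<in> edges G" "e \<noteq> f \<and> ends G e \<inter> ends G f \<noteq> {}"
    then have "1 \<le> \<bar>c e - c f\<bar>" "\<bar>c e - c f\<bar> \<le> r - 1"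
      using c by (auto simp: circular_edge_colouring_def)
    then show "1 \<le> \<bar>c' e - c' f\<bar>" "\<bar>c' e - c' f\<bar> \<le> r - 1"
      by (auto simp: c'_def)
  qed
  show "c' e0 = 0"
    by (simp add: c'_def)
qed

lemma circular_edge_colouring_sorted_wrt_apart:
  assumes "circular_edge_colouring G r c"
    and "set es \<subseteq> edges G" "\<forall>e\<in>set es. v \<in> ends G e" "distinct es"
  shows "sorted_wrt (apart r) (map c es)"
  using assms(2-)
proof (induction es)
  case (Cons e es)
  have "apart r (c e) (c f)" if "f \<in> set es" for f
  proof -
    have "e \<in> edges G" "f \<in> edges G" "e \<noteq> f" "ends G e \<inter> ends G f \<noteq> {}"
      using Cons.prems that by auto
    then show ?thesis
      using assms(1) by (auto simp: circular_edge_colouring_def apart_def)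
  qed
  then show ?case
    using Cons by auto
qed simp

text \<open>Reduces the check to one list per vertex: distinct edges meeting at \<open>v\<close>
  stand at different positions of the list for \<open>v\<close>, and \<open>apart\<close> is
  symmetric.\<close>

lemma circular_edge_colouring_if_incident:
  assumes "\<And>e. e \<in> edges G \<Longrightarrow> ends G e \<subseteq> verts G"
    and "\<And>e. e \<in> edges G \<Longrightarrow> 0 \<le> c e \<and> c e < r"
    and "\<And>v. v \<in> verts G \<Longrightarrow>
      \<exists>es. {e \<in> edges G. v \<in> ends G e} \<subseteq> set es \<and> sorted_wrt (apart r) (map c es)"
  shows "circular_edge_colouring G r c"
  unfolding circular_edge_colouring_def
proof (intro conjI ballI impI)
  fix e f assume ef: "e \<in> edges G" "f \<in> edges G" "e \<noteq> f \<and> ends G e \<inter> ends G f \<noteq> {}"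
  then obtain v where v: "v \<in> ends G e" "v \<in> ends G f"
    by blast
  with assms(1) ef obtain es where "{e \<in> edges G. v \<in> ends G e} \<subseteq> set es"
    and sorted: "sorted_wrt (apart r) (map c es)"
    using assms(3) by blast
  with ef v have "e \<in> set es" "f \<in> set es"
    by auto
  then obtain i j where ij: "i < length es" "j < length es" "e = es ! i" "f = es ! j"
    by (metis in_set_conv_nth)
  with ef(3) consider "i < j" | "j < i"
    by (metis linorder_neqE_nat)
  then have "apart r (c e) (c f)"
  proof cases
    case 1
    then show ?thesis
      using sorted_wrt_nth_less[OF sorted, of i j] ij by simp
  next
    case 2
    then show ?thesis
      using sorted_wrt_nth_less[OF sorted, of j i] ij by (simp add: apart_sym)
  qed
  then show "1 \<le> \<bar>c e - c f\<bar>" "\<bar>c e - c f\<bar> \<le> r - 1"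
    by (simp_all add: apart_def)
qed (use assms(2) in auto)

text \<open>The vertices of the gadget are \<open>0, \<dots>, 6\<close>. Here \<open>cij\<close> is the colour of the edge between
  \<open>i\<close> and \<open>j\<close>, \<open>dij\<close> that of a second such edge, and \<open>p0\<close>, \<open>p6\<close> are the colours of the pendant
  edges.\<close>

lemma gadget_not_colourable:
  assumes "r < 14 / 3" and "c06 = 0"
    and "\<forall>x\<in>{p0, p6, c01, c04, c12, d12, c13, c23, c26, c34, c35, c45, d45, c56}. 0 \<le> x \<and> x < r"
    and "sorted_wrt (apart r) [p0, c01, c04, c06]"
    and "sorted_wrt (apart r) [c01, c12, d12, c13]"
    and "sorted_wrt (apart r) [c12, d12, c23, c26]"
    and "sorted_wrt (apart r) [c13, c23, c34, c35]"
    and "sorted_wrt (apart r) [c04, c34, c45, d45]"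
    and "sorted_wrt (apart r) [c35, c45, d45, c56]"
    and "sorted_wrt (apart r) [c06, c26, c56, p6]"
  shows False
proof -
  \<comment> \<open>Unfolding leaves linear constraints and absolute values of differences; deciding
    the sign of each difference gives the case analysis on the order of colours.\<close>
  note conds = assms[unfolded apart_def sorted_wrt.simps list.set(1,2) ball_simps(5,7)
      simp_thms(21,22)]
  show False
    using conds [[argo_timeout = 900]] by argo
qed

text \<open>The edges \<open>2 * i\<close> form a Hamiltonian cycle. The gadget lives on the vertices below 7, and its
  pendant edges are \<open>12\<close> and \<open>2 * (n - 1)\<close>, which coincide for \<open>n = 7\<close>.\<close>

definition ring_ends :: "nat \<Rightarrow> nat \<Rightarrow> nat set" where
  "ring_ends n e = (let i = e div 2 in
     if even e then {i, Suc i mod n}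
     else if i < 7 then [{0, 6}, {0, 4}, {2, 6}, {3, 5}, {1, 3}, {1, 2}, {4, 5}] ! i
     else if odd i then {i, Suc i} else {i - 1, i})"

text \<open>The vertices from 7 on form \<open>k\<close> pairs, each starting at an odd vertex. A
  pair is joined by one cycle edge and two odd-numbered edges.\<close>

definition ring_graph :: "nat \<Rightarrow> (nat, nat) multigraph" where
  "ring_graph k = (let n = 2 * k + 7 in
     \<lparr>verts = {..<n}, edges = {..<2 * n}, ends = ring_ends n\<rparr>)"

section \<open>Incidence lists, regularity and looplessness\<close>

definition incident_extra :: "nat \<Rightarrow> nat list" where
  "incident_extra v =
     (if v < 7 then [[1, 3], [9, 11], [5, 11], [7, 9], [3, 13], [7, 13], [1, 5]] ! v
      else if odd v then [2 * v + 1, 2 * v + 3] else [2 * v - 1, 2 * v + 1])"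

definition incident :: "nat \<Rightarrow> nat \<Rightarrow> nat list" where
  "incident n v = 2 * (if v = 0 then n - 1 else v - 1) # 2 * v # incident_extra v"

lemma less_7_cases:
  assumes "(i::nat) < 7"
  obtains "i = 0" | "i = 1" | "i = 2" | "i = 3" | "i = 4" | "i = 5" | "i = 6"
  using assms by linarith

lemma ring_ends_even: "ring_ends n (2 * i) = {i, Suc i mod n}"
  by (simp add: ring_ends_def)

lemma ring_ends_odd:
  "ring_ends n (2 * i + 1) =
     (if i < 7 then [{0, 6}, {0, 4}, {2, 6}, {3, 5}, {1, 3}, {1, 2}, {4, 5}] ! i
      else if odd i then {i, Suc i} else {i - 1, i})"
  by (simp add: ring_ends_def)

lemma in_ring_ends_even_iff:
  assumes "i < n" "v < n"
  shows "v \<in> ring_ends n (2 * i) \<longleftrightarrow> i = v \<or> i = (if v = 0 then n - 1 else v - 1)"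
  using assms by (cases "Suc i = n") (auto simp: ring_ends_even)

lemma ring_edge_cases:
  fixes e n :: nat
  assumes "e < 2 * n"
  obtains i where "i < n" "e = 2 * i" | i where "i < n" "e = 2 * i + 1"
  using assms by (cases "even e") (auto elim!: evenE oddE)

lemma odd_incident_extra:
  assumes "x \<in> set (incident_extra v)"
  shows "odd x"
proof (cases "v < 7")
  case True
  then show ?thesis
    using assms by (cases rule: less_7_cases) (auto simp: incident_extra_def)
next
  case False
  then show ?thesis
    using assms by (auto simp: incident_extra_def split: if_splits)
qed

lemma in_incident_extra_iff:
  "2 * i + 1 \<in> set (incident_extra v) \<longleftrightarrow> v \<in> ring_ends n (2 * i + 1)"
proof (cases "i < 7")
  case i: True
  show ?thesis
  proof (cases "v < 7")
    case True
    from this i show ?thesis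
      by (elim less_7_cases) (simp_all add: incident_extra_def ring_ends_def)
  next
    case False
    \<comment> \<open>Parity excludes \<open>v = 7\<close>, so the edge \<open>2 * v - 1\<close> is
      at least 15 and is no gadget edge.\<close>
    moreover from False have "even v \<Longrightarrow> 8 \<le> v"
      by presburger
    ultimately show ?thesis
      using i by (elim less_7_cases) (auto simp: incident_extra_def ring_ends_def)
  qed
next
  case i: False
  show ?thesis
  proof (cases "v < 7")
    case True
    moreover from i have "even i \<Longrightarrow> 8 \<le> i"
      by presburger
    ultimately show ?thesis
      using i by (elim less_7_cases) (auto simp: incident_extra_def ring_ends_def)
  next
    case False
    with i show ?thesis
      by (simp add: incident_extra_def ring_ends_def) presburger
  qed
qed

lemma incident_extra_less:
  assumes "n = 2 * k + 7" "v < n" "x \<in> set (incident_extra v)"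
  shows "x < 2 * n"
proof (cases "v < 7")
  case True
  then show ?thesis
    using assms by (cases rule: less_7_cases) (auto simp: incident_extra_def)
next
  case False
  \<comment> \<open>The last vertex \<open>n - 1\<close> is even, so the pair of an odd
    \<open>v\<close> does not run past the end.\<close>
  have "odd v \<Longrightarrow> Suc v < n"
    using assms by presburger
  then show ?thesis
    using assms False by (auto simp: incident_extra_def split: if_splits)
qed

lemma incident_eq:
  assumes n: "n = 2 * k + 7" and v: "v < n"
  shows "{e. e < 2 * n \<and> v \<in> ring_ends n e} = set (incident n v)" (is "?A = ?B")
proof (rule set_eqI)
  fix e
  show "e \<in> ?A \<longleftrightarrow> e \<in> ?B"
  proof (cases "even e")
    case True
    then obtain i where "e = 2 * i" ..
    then show ?thesis
      using v in_ring_ends_even_iff[of i n v] odd_incident_extra[of e v]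
      by (auto simp: incident_def)
  next
    case False
    then have "e \<in> set (incident_extra v) \<longleftrightarrow> v \<in> ring_ends n e"
      using in_incident_extra_iff by (auto elim: oddE)
    then show ?thesis
      using False incident_extra_less[OF n v] by (auto simp: incident_def)
  qed
qed

lemma distinct_incident:
  assumes "n = 2 * k + 7" "v < n"
  shows "distinct (incident n v)" "length (incident n v) = 4"
proof -
  have "distinct (incident_extra v) \<and> length (incident_extra v) = 2"
  proof (cases "v < 7")
    case True
    then show ?thesis
      by (cases rule: less_7_cases) (simp_all add: incident_extra_def)
  qed (auto simp: incident_extra_def)
  moreover have "2 * i \<notin> set (incident_extra v)" for i
    using odd_incident_extra by fastforce
  ultimately show "distinct (incident n v)" "length (incident n v) = 4"
    using assms by (auto simp: incident_def)
qed

lemma ring_graph_sel: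
  "verts (ring_graph k) = {..<2 * k + 7}"
  "edges (ring_graph k) = {..<2 * (2 * k + 7)}"
  "ends (ring_graph k) = ring_ends (2 * k + 7)"
  by (simp_all add: ring_graph_def Let_def)

lemma incident_ring_graph:
  assumes "v < 2 * k + 7"
  shows "{e \<in> edges (ring_graph k). v \<in> ends (ring_graph k) e} = set (incident (2 * k + 7) v)"
  using incident_eq[OF refl assms] by (simp add: ring_graph_sel)

lemma regular_ring_graph: "regular 4 (ring_graph k)"
  unfolding regular_def degree_def
proof
  fix v assume "v \<in> verts (ring_graph k)"
  then have v: "v < 2 * k + 7"
    by (simp add: ring_graph_sel)
  show "card {e \<in> edges (ring_graph k). v \<in> ends (ring_graph k) e} = 4"
    using distinct_incident[OF refl v] by (simp add: incident_ring_graph[OF v] distinct_card)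
qed

lemma finite_loopless_ring_graph: "finite_loopless_multigraph (ring_graph k)"
  unfolding finite_loopless_multigraph_def
proof (intro conjI ballI)
  fix e assume "e \<in> edges (ring_graph k)"
  then have "e < 2 * (2 * k + 7)"
    by (simp add: ring_graph_sel)
  then show "ends (ring_graph k) e \<subseteq> verts (ring_graph k)" "card (ends (ring_graph k) e) = 2"
  proof (atomize (full), cases rule: ring_edge_cases)
    case (1 i)
    have "Suc i mod (2 * k + 7) \<noteq> i"
    proof (cases "Suc i = 2 * k + 7")
      case True
      then show ?thesis
        by (simp only: True mod_self) (use True in linarith)
    next
      case False
      then show ?thesis
        using 1 by simp
    qed
    with 1 show "ends (ring_graph k) e \<subseteq> verts (ring_graph k) \<and> card (ends (ring_graph k) e) = 2"
      by (auto simp: ring_graph_sel ring_ends_even card_insert_if)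
  next
    case (2 i)
    have "odd i \<Longrightarrow> Suc i < 2 * k + 7"
      using \<open>i < 2 * k + 7\<close> by presburger
    with 2 show "ends (ring_graph k) e \<subseteq> verts (ring_graph k) \<and> card (ends (ring_graph k) e) = 2"
      unfolding ring_graph_sel \<open>e = 2 * i + 1\<close> ring_ends_odd
      by (cases "i < 7") (auto elim!: less_7_cases simp: card_insert_if)
  qed
qed (auto simp: ring_graph_sel)

section \<open>Connectivity\<close>

lemma sym_adj_rel: "sym (adj_rel G)"
  by (auto simp: adj_rel_def sym_def insert_commute)

lemma connected_multigraph_if_path:
  assumes "verts G = p ` {a..<b}" "a < b"
    and "\<And>j. a \<le> j \<Longrightarrow> Suc j < b \<Longrightarrow> (p j, p (Suc j)) \<in> adj_rel G"
  shows "connected_multigraph G"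
proof -
  have reach: "(p a, p j) \<in> (adj_rel G)\<^sup>*" if "a \<le> j" "j < b" for j
    using that(1) that(2)
  proof (induction j rule: dec_induct)
    case (step j)
    then show ?case
      using assms(3)[of j] by (meson Suc_lessD rtrancl.rtrancl_into_rtrancl)
  qed simp
  have sym: "sym ((adj_rel G)\<^sup>*)"
    by (intro sym_rtrancl sym_adj_rel)
  have "(p i, p j) \<in> (adj_rel G)\<^sup>*" if "a \<le> i" "i < b" "a \<le> j" "j < b" for i j
    using reach[OF that(1,2)] reach[OF that(3,4)] sym by (meson rtrancl_trans symD)
  then show ?thesis
    using assms(1,2) by (auto simp: connected_multigraph_def)
qed

text \<open>A cycle minus at most one vertex contains a path through all remaining vertices.\<close>

lemma vertex_connected_2_if_Hamiltonian_cycle: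
  assumes verts: "verts G = {..<n}" and n: "2 < n"
    and cycle: "\<And>i. i < n \<Longrightarrow> \<exists>e\<in>edges G. ends G e = {i, Suc i mod n}"
  shows "vertex_connected 2 G"
  unfolding vertex_connected_def
proof (intro conjI allI impI)
  fix X assume X: "X \<subseteq> verts G" "card X < 2"
  have "finite X"
    using X(1) verts finite_subset by fastforce
  with X have "X = {} \<or> (\<exists>x<n. X = {x})"
    using verts by (auto simp: numeral_2_eq_2 less_Suc_eq card_1_singleton_iff)
  then obtain x where x: "x < n" and X_cases: "X = {} \<or> X = {x}"
  proof
    assume "X = {}"
    then show thesis
      using that[of 0] n by simp
  qed (use that in blast)
  \<comment> \<open>The walk \<open>p\<close> goes round the cycle from \<open>x = p 0\<close>;
    starting it at index \<open>a\<close> skips \<open>x\<close> exactly when \<open>x\<close> is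
    deleted.\<close>
  define a :: nat where "a = (if X = {} then 0 else 1)"
  define p where "p j = (x + j) mod n" for j
  have p_inj: "i = j" if "p i = p j" "i < n" "j < n" for i j
  proof -
    have "[x + i = x + j] (mod n)"
      using that(1) by (simp add: cong_def p_def)
    then have "[i = j] (mod n)"
      by (simp add: cong_add_lcancel_nat)
    then show ?thesis
      using that(2,3) by (simp add: cong_def)
  qed
  have p0: "p 0 = x"
    using x by (simp add: p_def)
  have surj: "p ` {..<n} = {..<n}"
  proof (rule endo_inj_surj)
    show "p ` {..<n} \<subseteq> {..<n}"
      using n by (auto simp: p_def)
    show "inj_on p {..<n}"
      by (auto intro: inj_onI p_inj)
  qed simp
  have "{..<n} = insert 0 {1..<n}"
    using n by auto
  then have insert_x: "{..<n} = insert x (p ` {1..<n})"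
    using surj p0 by (metis image_insert)
  have x_notin: "x \<notin> p ` {1..<n}"
  proof
    assume "x \<in> p ` {1..<n}"
    then obtain j where "p 0 = p j" "1 \<le> j" "j < n"
      using p0 by auto
    then show False
      using p_inj[of 0 j] by simp
  qed
  have p_image: "verts G - X = p ` {a..<n}"
  proof (cases "X = {}")
    case True
    then show ?thesis
      using surj verts by (simp add: a_def lessThan_atLeast0)
  next
    case False
    then show ?thesis
      using X_cases insert_x x_notin verts by (simp add: a_def)
  qed
  show "connected_multigraph (delete_verts G X)"
  proof (rule connected_multigraph_if_path[where p = p and a = a and b = n])
    show "verts (delete_verts G X) = p ` {a..<n}"
      using p_image by (simp add: delete_verts_def)
    show "a < n"
      using n by (simp add: a_def)
    fix j assume j: "a \<le> j" "Suc j < n"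
    have "p j < n"
      using n by (simp add: p_def)
    then obtain e where e: "e \<in> edges G" "ends G e = {p j, Suc (p j) mod n}"
      using cycle by blast
    moreover have "Suc (p j) mod n = p (Suc j)"
      by (simp add: p_def mod_Suc_eq)
    moreover have "p j \<in> verts G - X" "p (Suc j) \<in> verts G - X"
      unfolding p_image using j by auto
    ultimately show "(p j, p (Suc j)) \<in> adj_rel (delete_verts G X)"
      by (auto simp: adj_rel_def delete_verts_def)
  qed
qed (use verts n in simp)

lemma vertex_connected_ring_graph: "vertex_connected 2 (ring_graph k)"
proof (rule vertex_connected_2_if_Hamiltonian_cycle[where n = "2 * k + 7"])
  fix i assume "i < 2 * k + 7"
  then show "\<exists>e\<in>edges (ring_graph k). ends (ring_graph k) e = {i, Suc i mod (2 * k + 7)}"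
    by (intro bexI[of _ "2 * i"]) (simp_all add: ring_graph_sel ring_ends_even)
qed (simp_all add: ring_graph_sel)

section \<open>A colouring for 14 / 3\<close>

text \<open>The edges below 14 are the inner gadget edges and the pendant edge 12; they use each
  multiple of 1/3 in the range exactly once. Single ring edges get 0, like edge 12, and the three
  edges of a pair get 1, 2, 3.\<close>

definition ring_colour :: "nat \<Rightarrow> real" where
  "ring_colour e =
     (if e < 14 then [3, 7, 6, 11, 2, 10, 5, 12, 1, 9, 4, 13, 0, 8] ! e / 3
      else if even e then (if odd (e div 2) then 1 else 0)
      else (if odd (e div 2) then 2 else 3))"

lemma ring_colour_bounds: "0 \<le> ring_colour e" "ring_colour e < 14 / 3"
proof -
  have "\<forall>x\<in>set [3, 7, 6, 11, 2, 10, 5, 12, 1, 9, 4, 13, 0, 8::real]. 0 \<le> x / 3 \<and> x / 3 < 14 / 3"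
    by simp
  then have "e < 14 \<Longrightarrow> 0 \<le> ring_colour e \<and> ring_colour e < 14 / 3"
    unfolding ring_colour_def by (simp only: if_True) (drule bspec, rule nth_mem, simp_all)
  then show "0 \<le> ring_colour e" "ring_colour e < 14 / 3"
    by (cases "e < 14"; simp add: ring_colour_def)+
qed

text \<open>The even pattern already holds at index 6, because edge 12 has colour 0; the odd one
  starts after the gadget.\<close>

lemma ring_colour_chain:
  assumes "6 \<le> i"
  shows "ring_colour (2 * i) = (if odd i then 1 else 0)"
    and "7 \<le> i \<Longrightarrow> ring_colour (2 * i + 1) = (if odd i then 2 else 3)"
  using assms by (cases "i = 6"; simp add: ring_colour_def)+

lemma ring_colour_incident:
  assumes "n = 2 * k + 7" "v < n"
  shows "sorted_wrt (apart (14 / 3)) (map ring_colour (incident n v))"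
proof (cases "v < 7")
  case True
  \<comment> \<open>This is the pendant edge at vertex 0: edge 12 itself if \<open>k = 0\<close>,
    otherwise a single ring edge, as \<open>n - 1\<close> is even.\<close>
  have "ring_colour (2 * (n - 1)) = 0"
    using assms by (auto simp: ring_colour_def)
  with True show ?thesis
    by (cases rule: less_7_cases)
      (simp_all add: incident_def incident_extra_def ring_colour_def apart_def)
next
  case False
  then obtain u where "v = Suc u" and "6 \<le> u"
    by (cases v) auto
  moreover from \<open>6 \<le> u\<close> have "odd u \<Longrightarrow> 7 \<le> u"
    by (cases "u = 6") auto
  ultimately show ?thesis
    using ring_colour_chain(1)[of u] ring_colour_chain(2)[of u] ring_colour_chain[of "Suc u"]
      ring_colour_chain(2)[of "Suc (Suc u)"]
    by (cases "odd u") (auto simp: incident_def incident_extra_def apart_def numeral_3_eq_3)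
qed

lemma ring_graph_colourable: "circular_edge_colouring (ring_graph k) (14 / 3) ring_colour"
proof (rule circular_edge_colouring_if_incident)
  fix v assume "v \<in> verts (ring_graph k)"
  then have v: "v < 2 * k + 7"
    by (simp add: ring_graph_sel)
  show "\<exists>es. {e \<in> edges (ring_graph k). v \<in> ends (ring_graph k) e} \<subseteq> set es \<and>
      sorted_wrt (apart (14 / 3)) (map ring_colour es)"
    using incident_ring_graph[OF v] ring_colour_incident[OF refl v] by blast
next
  show "ends (ring_graph k) e \<subseteq> verts (ring_graph k)" if "e \<in> edges (ring_graph k)" for e
    using finite_loopless_ring_graph that by (simp add: finite_loopless_multigraph_def)
  show "0 \<le> ring_colour e \<and> ring_colour e < 14 / 3" for e
    using ring_colour_bounds by blast
qed

section \<open>The lower bound and the family\<close>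

lemma ring_graph_colouring_ge:
  assumes "circular_edge_colouring (ring_graph k) r c"
  shows "14 / 3 \<le> r"
proof (rule ccontr)
  assume "\<not> 14 / 3 \<le> r"
  then have r: "r < 14 / 3"
    by simp
  \<comment> \<open>Edge 1 joins 0 and 6, so its colour plays the role of
    \<open>c06\<close>.\<close>
  obtain c' where c': "circular_edge_colouring (ring_graph k) r c'" and zero: "c' 1 = 0"
    using circular_edge_colouring_rotate[OF assms, of 1] by (auto simp: ring_graph_sel)
  have bounds: "0 \<le> c' e \<and> c' e < r" if "e < 2 * (2 * k + 7)" for e
    using c' that by (auto simp: circular_edge_colouring_def ring_graph_sel)
  \<comment> \<open>Arbitrary reorderings are allowed in order to match the lists of
    \<open>gadget_not_colourable\<close>.\<close>
  have at_vertex: "sorted_wrt (apart r) (map c' es)"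
    if "v < 2 * k + 7" "mset es = mset (incident (2 * k + 7) v)" for v es
  proof (rule circular_edge_colouring_sorted_wrt_apart[OF c'])
    have "set es = set (incident (2 * k + 7) v)" "distinct es"
      using that distinct_incident[OF refl that(1)] by (metis set_mset_mset, metis mset_eq_imp_distinct_iff)
    then show "set es \<subseteq> edges (ring_graph k)" "\<forall>e\<in>set es. v \<in> ends (ring_graph k) e" "distinct es"
      using incident_ring_graph[OF that(1)] by auto
  qed
  \<comment> \<open>The pendant edges are \<open>?last\<close> at 0 and 12 at 6. For
    \<open>k = 0\<close> they coincide and \<open>p0 = p6\<close>, which the gadget lemma
    permits.\<close>
  let ?last = "2 * (2 * k + 6)"
  show False
  proof (rule gadget_not_colourable[OF r zero])
    show "\<forall>x\<in>{c' ?last, c' 12, c' 0, c' 3, c' 2, c' 11, c' 9, c' 4, c' 5, c' 6, c' 7, c' 8, c' 13, c' 10}.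
        0 \<le> x \<and> x < r"
      using bounds by auto
    show "sorted_wrt (apart r) [c' ?last, c' 0, c' 3, c' 1]"
      using at_vertex[of 0 "[?last, 0, 3, 1]"] by (simp add: incident_def incident_extra_def)
    show "sorted_wrt (apart r) [c' 0, c' 2, c' 11, c' 9]"
      using at_vertex[of 1 "[0, 2, 11, 9]"] by (simp add: incident_def incident_extra_def)
    show "sorted_wrt (apart r) [c' 2, c' 11, c' 4, c' 5]"
      using at_vertex[of 2 "[2, 11, 4, 5]"] by (simp add: incident_def incident_extra_def)
    show "sorted_wrt (apart r) [c' 9, c' 4, c' 6, c' 7]"
      using at_vertex[of 3 "[9, 4, 6, 7]"] by (simp add: incident_def incident_extra_def)
    show "sorted_wrt (apart r) [c' 3, c' 6, c' 8, c' 13]"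
      using at_vertex[of 4 "[3, 6, 8, 13]"] by (simp add: incident_def incident_extra_def)
    show "sorted_wrt (apart r) [c' 7, c' 8, c' 13, c' 10]"
      using at_vertex[of 5 "[7, 8, 13, 10]"] by (simp add: incident_def incident_extra_def)
    show "sorted_wrt (apart r) [c' 1, c' 5, c' 10, c' 12]"
      using at_vertex[of 6 "[1, 5, 10, 12]"] by (simp add: incident_def incident_extra_def)
  qed
qed

lemma circular_chromatic_index_ring_graph: "circular_chromatic_index (ring_graph k) = 14 / 3"
  unfolding circular_chromatic_index_def
  using ring_graph_colourable ring_graph_colouring_ge by (intro cInf_eq_minimum) auto

lemma isomorphic_ring_graph_imp_eq: "isomorphic (ring_graph k) (ring_graph l) \<Longrightarrow> k = l"
  by (auto simp: isomorphic_def ring_graph_sel dest: bij_betw_same_card)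

theorem theorem8:
  "\<exists>S :: (nat, nat) multigraph set.
     infinite S \<and>
     (\<forall>G\<in>S. finite_loopless_multigraph G \<and> vertex_connected 2 G \<and> regular 4 G \<and>
        circular_chromatic_index G = 4 + 2 / 3) \<and>
     (\<forall>G\<in>S. \<forall>H\<in>S. G \<noteq> H \<longrightarrow> \<not> isomorphic G H)"
proof (intro exI conjI)
  have "inj ring_graph"
    by (rule injI, drule arg_cong[where f = "\<lambda>G. card (verts G)"]) (simp add: ring_graph_sel)
  then show "infinite (range ring_graph)"
    by (simp add: finite_image_iff)
  show "\<forall>G\<in>range ring_graph. finite_loopless_multigraph G \<and> vertex_connected 2 G \<and>
      regular 4 G \<and> circular_chromatic_index G = 4 + 2 / 3"
    by (simp add: finite_loopless_ring_graph vertex_connected_ring_graph regular_ring_graph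
        circular_chromatic_index_ring_graph)
  show "\<forall>G\<in>range ring_graph. \<forall>H\<in>range ring_graph. G \<noteq> H \<longrightarrow> \<not> isomorphic G H"
    using isomorphic_ring_graph_imp_eq by blast
qed

end
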